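(* Let $\mathcal{M}=\mathcal{M}(G;r,\ell)$ be an orientably-regular map with $G=\mathrm{Aut}^+(\mathcal{M})$. Let $\pi$ be the set of prime divisors of the number of vertices of $\mathcal{M}$. If $G$ acts primitively on the set of vertices of $\mathcal{M}$, then $\pi$ consists of a single prime.
   Context: An orientably-regular map $\mathcal{M}(G;r,\ell)$ has $G=\langle r,\ell\rangle$ finite and $\ell$ an involution. Here $G\cong\mathrm{Aut}^+(\mathcal{M})$ acts regularly on darts. The vertices are the cosets of $\langle r\rangle$, on which $G$ acts by multiplication, so the vertex stabiliser is a conjugate of the cyclic group $\langle r\rangle$. *)

theory Defs
  imports "HOL-Algebra.Algebra" "HOL-Computational_Algebra.Primes"
begin

text \<open>
  The algebraic description of the orientably-regular map \<open>\<M>(G; r, \<ell>)\<close>: the darts are the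
  elements of \<open>G\<close>, and the orientation-preserving automorphism group is \<open>G\<close> itself, acting
  regularly on the darts by left multiplication.  As in the usual convention, \<open>r\<close> is arbitrary
  apart from the generation condition, so it may be trivial or equal to \<open>\<ell>\<close>.
\<close>

locale orientably_regular_map = group G for G (structure) +
  fixes r l
  assumes finite_carrier: "finite (carrier G)"
    and r_closed: "r \<in> carrier G"
    and l_closed: "l \<in> carrier G"
    and generated: "carrier G = generate G {r, l}"
    and l_involution: "ord l = 2"

text \<open>
  Left cosets are used so that \<open>G\<close> acts on the left, as \<^locale>\<open>group_action\<close> requires.
\<close>

definition map_vertices :: "('a, 'b) monoid_scheme \<Rightarrow> 'a \<Rightarrow> 'a set set"
  where "map_vertices G r = lcosets\<^bsub>G\<^esub> (generate G {r})"

definition vertex_action :: "('a, 'b) monoid_scheme \<Rightarrow> 'a \<Rightarrow> 'a \<Rightarrow> 'a set \<Rightarrow> 'a set"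
  where "vertex_action G r g = (\<lambda>C \<in> map_vertices G r. g <#\<^bsub>G\<^esub> C)"

definition action_block ::
    "('a, 'c) monoid_scheme \<Rightarrow> 'b set \<Rightarrow> ('a \<Rightarrow> 'b \<Rightarrow> 'b) \<Rightarrow> 'b set \<Rightarrow> bool"
  where "action_block G E \<phi> B \<longleftrightarrow>
    B \<subseteq> E \<and> B \<noteq> {} \<and> (\<forall>g \<in> carrier G. \<phi> g ` B = B \<or> \<phi> g ` B \<inter> B = {})"

text \<open>
  The action on a single point is not primitive here.  With this convention an action is
  primitive iff it is transitive and the point stabilisers are maximal (in particular proper)
  subgroups.
\<close>

locale primitive_action = transitive_action +
  assumes not_singleton: "\<exists>x \<in> E. \<exists>y \<in> E. x \<noteq> y"
    and trivial_blocks: "action_block G E \<phi> B \<Longrightarrow> (\<exists>x. B = {x}) \<or> B = E"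

text \<open>The vertices do carry a transitive action, with \<open>\<langle>r\<rangle>\<close> as the stabiliser of the base vertex.\<close>

context orientably_regular_map
begin

lemma subgroup_r: "subgroup (generate G {r}) G"
  using r_closed by (intro generate_is_subgroup) auto

lemma subset_r: "generate G {r} \<subseteq> carrier G"
  using subgroup_r by (rule subgroup.subset)

lemma vertex_subset: "C \<in> map_vertices G r \<Longrightarrow> C \<subseteq> carrier G"
  unfolding map_vertices_def
  using subgroup.lcosets_carrier[OF subgroup_r is_group] by blast

lemma vertex_mult:
  assumes "g \<in> carrier G" "C \<in> map_vertices G r"
  shows "g <# C \<in> map_vertices G r"
  using assms subset_r unfolding map_vertices_def LCOSETS_def
  by (auto simp: lcos_m_assoc)

lemma vertex_action_Bij:
  assumes g: "g \<in> carrier G"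
  shows "vertex_action G r g \<in> Bij (map_vertices G r)"
proof -
  have "bij_betw (\<lambda>C. g <# C) (map_vertices G r) (map_vertices G r)"
  proof (rule bij_betw_byWitness[where f' = "\<lambda>C. inv g <# C"])
    show "\<forall>C\<in>map_vertices G r. inv g <# (g <# C) = C"
      using g vertex_subset by (simp add: lcos_m_assoc lcos_mult_one)
    show "\<forall>C\<in>map_vertices G r. g <# (inv g <# C) = C"
      using g vertex_subset by (simp add: lcos_m_assoc lcos_mult_one)
  qed (use g vertex_mult in auto)
  then show ?thesis
    by (simp add: Bij_def vertex_action_def cong: bij_betw_cong)
qed

lemma transitive_action_vertices:
  "transitive_action G (map_vertices G r) (vertex_action G r)"
proof -
  interpret B: group "BijGroup (map_vertices G r)"
    by (rule group_BijGroup)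
  show ?thesis
  proof
    show "vertex_action G r \<in> hom G (BijGroup (map_vertices G r))"
    proof (rule homI)
      fix g h assume gh: "g \<in> carrier G" "h \<in> carrier G"
      show "vertex_action G r (g \<otimes> h) =
          vertex_action G r g \<otimes>\<^bsub>BijGroup (map_vertices G r)\<^esub> vertex_action G r h"
      proof
        fix C
        have "vertex_action G r g \<otimes>\<^bsub>BijGroup (map_vertices G r)\<^esub> vertex_action G r h =
            compose (map_vertices G r) (vertex_action G r g) (vertex_action G r h)"
          using gh by (simp add: BijGroup_def vertex_action_Bij)
        then show "vertex_action G r (g \<otimes> h) C =
            (vertex_action G r g \<otimes>\<^bsub>BijGroup (map_vertices G r)\<^esub> vertex_action G r h) C"
          using gh vertex_mult vertex_subset
          by (simp add: vertex_action_def compose_def lcos_m_assoc)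
      qed
    qed (simp add: BijGroup_def vertex_action_Bij)
  next
    fix C D assume "C \<in> map_vertices G r" "D \<in> map_vertices G r"
    then obtain a b where ab: "a \<in> carrier G" "b \<in> carrier G"
      and CD: "C = a <# generate G {r}" "D = b <# generate G {r}"
      and C: "C \<in> map_vertices G r"
      by (auto simp: map_vertices_def LCOSETS_def)
    have "vertex_action G r (b \<otimes> inv a) C = D"
      using ab subset_r C by (simp add: vertex_action_def CD lcos_m_assoc m_assoc)
    then show "\<exists>g\<in>carrier G. vertex_action G r g C = D"
      using ab by blast
  qed
qed

lemma base_vertex: "generate G {r} \<in> map_vertices G r"
  using lcos_mult_one[OF subset_r] unfolding map_vertices_def LCOSETS_def by force

lemma stabilizer_base_vertex:
  "stabilizer G (vertex_action G r) (generate G {r}) = generate G {r}"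
proof -
  have "g <# generate G {r} = generate G {r} \<longleftrightarrow> g \<in> generate G {r}" if "g \<in> carrier G" for g
    using that subgroup_r lcos_self[OF that subgroup_r]
      l_repr_independence[OF _ one_closed subgroup_r] lcos_mult_one[OF subset_r] by metis
  then show ?thesis
    using subset_r base_vertex by (auto simp: stabilizer_def vertex_action_def)
qed

end

end

theory Submission
  imports Defs
begin

text \<open>
  Primitivity makes \<open>A = \<langle>r\<rangle>\<close> a maximal subgroup of \<open>G\<close>, and a maximal cyclic subgroup of a
  finite group has prime power index. Divide out the core of \<open>A\<close>: the centraliser of an element
  of \<open>A \<inter> x A x\<^sup>-\<^sup>1\<close> with \<open>x \<notin> A\<close> contains \<open>A\<close>, so maximality forces that intersection to become
  trivial. Hence \<open>A\<close> is a Frobenius complement. Since \<open>A\<close> is abelian, its normal complement \<open>N\<close> is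
  the kernel of the transfer \<open>G \<rightarrow> A\<close>, which is the identity on \<open>A\<close>. The generator \<open>a\<close> of \<open>A\<close> maps a
  Sylow \<open>p\<close>-subgroup \<open>P\<close> of \<open>N\<close> to an \<open>N\<close>-conjugate of \<open>P\<close>; because \<open>N a\<close> consists of the
  \<open>N\<close>-conjugates of \<open>a\<close> unless \<open>a = 1\<close>, some conjugate of \<open>P\<close> is normalised by \<open>A\<close>. Maximality
  gives \<open>P A = G\<close>, so the index of \<open>A\<close> is \<open>card P\<close>.
\<close>

section \<open>Sylow subgroups\<close>

text \<open>Orbit lengths divide \<open>p ^ k\<close> and sum to \<open>card E\<close>, so some
  orbit has length prime to \<open>p\<close> and is a single point.\<close>

lemma (in group_action) p_group_fixed_point:
  assumes p: "Factorial_Ring.prime p" and ord: "order G = p ^ k"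
    and "finite E" and "\<not> p dvd card E"
  obtains x where "x \<in> E" "\<And>g. g \<in> carrier G \<Longrightarrow> \<phi> g x = x"
proof -
  have "card E = (\<Sum>Y\<in>orbits G E \<phi>. card Y)"
    using disjoint_sum[OF \<open>finite E\<close>, of "\<lambda>_. 1 :: nat"] by simp
  then obtain Y where "Y \<in> orbits G E \<phi>" "\<not> p dvd card Y"
    using assms(4) by (metis dvd_sum)
  then obtain x where x: "x \<in> E" "\<not> p dvd card (orbit G \<phi> x)"
    by (auto simp: orbits_def)
  have "card (orbit G \<phi> x) dvd p ^ k"
    using orbit_stabilizer_theorem[OF x(1)] ord by (metis dvd_triv_left)
  then obtain j where j: "card (orbit G \<phi> x) = p ^ j"
    using p by (meson divides_primepow_nat)
  then have "card (orbit G \<phi> x) = 1"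
    using x(2) by (cases j) auto
  then have "orbit G \<phi> x = {x}"
    using orbit_refl[OF x(1)] by (metis card_1_singletonE singletonD)
  then show thesis
    using that[OF x(1)] by (auto simp: orbit_def)
qed

context group
begin

text \<open>Serves twice: restricted to a \<open>p\<close>-subgroup for Sylow conjugacy, and to
  reindex the product in the transfer.\<close>

lemma action_on_lcosets:
  assumes H: "subgroup H G"
  shows "group_action G (lcosets H) (\<lambda>g. \<lambda>C \<in> lcosets H. g <# C)"
proof -
  have sub: "C \<subseteq> carrier G" if "C \<in> lcosets H" for C
    using subgroup.lcosets_carrier[OF H is_group that] .
  have mem: "g <# C \<in> lcosets H" if "g \<in> carrier G" "C \<in> lcosets H" for g C
    using that subgroup.subset[OF H] unfolding LCOSETS_def by (auto simp: lcos_m_assoc)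
  have bij: "(\<lambda>C \<in> lcosets H. g <# C) \<in> Bij (lcosets H)" if g: "g \<in> carrier G" for g
  proof -
    have "bij_betw (\<lambda>C. g <# C) (lcosets H) (lcosets H)"
      by (rule bij_betw_byWitness[where f' = "\<lambda>C. inv g <# C"])
        (use g sub mem in \<open>auto simp: lcos_m_assoc lcos_mult_one\<close>)
    then show ?thesis
      by (simp add: Bij_def cong: bij_betw_cong)
  qed
  have "(\<lambda>g. \<lambda>C \<in> lcosets H. g <# C) \<in> hom G (BijGroup (lcosets H))"
    using bij sub mem
    by (auto simp: hom_def BijGroup_def compose_def lcos_m_assoc restrict_def fun_eq_iff)
  then show ?thesis
    by (simp add: group_action_def group_hom_def group_hom_axioms_def group_BijGroup is_group)
qed

text \<open>\<open>Q\<close> acts on the left cosets of \<open>P\<close>, whose number is prime to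
  \<open>p\<close>. A fixed coset \<open>x <# P\<close> puts \<open>Q\<close> inside the conjugate
  of \<open>P\<close> by \<open>x\<close>.\<close>

lemma p_subgroup_in_conjugate_of_sylow:
  assumes fin: "finite (carrier G)" and P: "subgroup P G" and Q: "subgroup Q G"
    and p: "Factorial_Ring.prime p" "card Q = p ^ k" "\<not> p dvd card (lcosets P)"
  obtains x where "x \<in> carrier G" "\<And>q. q \<in> Q \<Longrightarrow> inv x \<otimes> q \<otimes> x \<in> P"
proof -
  interpret act: group_action "G\<lparr>carrier := Q\<rparr>" "lcosets P" "\<lambda>g. \<lambda>C \<in> lcosets P. g <# C"
    using group_action.induced_action[OF action_on_lcosets[OF P] Q] .
  have "finite (lcosets P)"
    using lcosets_subset_PowG[OF P] fin finite_subset by blast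
  then obtain C where C: "C \<in> lcosets P" "\<And>q. q \<in> Q \<Longrightarrow> q <# C = C"
    using act.p_group_fixed_point[OF p(1), of k] p by (auto simp: order_def)
  then obtain x where x: "x \<in> carrier G" "C = x <# P"
    by (auto simp: LCOSETS_def)
  have "inv x \<otimes> q \<otimes> x \<in> P" if q: "q \<in> Q" for q
  proof -
    have "q \<otimes> x \<in> q <# C"
      using lcos_self[OF x(1) P] unfolding x(2) l_coset_def[of G q] by blast
    then have "inv x \<otimes> (q \<otimes> x) \<in> P"
      using subgroup.lcos_module_imp[OF P is_group x(1)] C(2)[OF q] x(2) by simp
    then show ?thesis
      using q x(1) subgroup.mem_carrier[OF Q] by (simp add: m_assoc)
  qed
  then show thesis
    using that x(1) by blast
qed

lemma card_set_mult_trivial_inter: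
  assumes H: "subgroup H G" and K: "subgroup K G" and "H \<inter> K = {\<one>}"
  shows "card (H <#> K) = card H * card K"
proof -
  have "inj_on (\<lambda>(h, k). h \<otimes> k) (H \<times> K)"
  proof (rule inj_onI, clarify)
    fix h k h' k' assume mem: "h \<in> H" "k \<in> K" "h' \<in> H" "k' \<in> K" and eq: "h \<otimes> k = h' \<otimes> k'"
    have c: "h \<in> carrier G" "k \<in> carrier G" "h' \<in> carrier G" "k' \<in> carrier G"
      using mem H K by (auto dest: subgroup.mem_carrier)
    have "inv h' \<otimes> h = k' \<otimes> inv k"
      using c eq by (metis inv_closed inv_solve_left inv_solve_right m_assoc m_closed)
    moreover have "inv h' \<otimes> h \<in> H" "k' \<otimes> inv k \<in> K"
      using mem H K by (auto intro: subgroup.m_closed subgroup.m_inv_closed)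
    ultimately have "inv h' \<otimes> h = \<one>" "k' \<otimes> inv k = \<one>"
      using assms(3) by auto
    then show "h = h' \<and> k = k'"
      using c by (metis inv_closed inv_equality inv_inv)
  qed
  moreover have "H <#> K = (\<lambda>(h, k). h \<otimes> k) ` (H \<times> K)"
    by (auto simp: set_mult_def)
  ultimately show ?thesis
    by (simp add: card_image card_cartesian_product)
qed

end

section \<open>Transfer into an abelian subgroup\<close>

context group
begin

text \<open>
  A function \<open>f\<close> with \<open>f (x \<otimes> c) = f x \<otimes> c\<close> encodes the transversal \<open>{x. f x = \<one>}\<close> of the left cosets
  of \<open>A\<close>; each factor of the product does not depend on the representative that is chosen.
\<close>

definition transfer :: "'a set \<Rightarrow> ('a \<Rightarrow> 'a) \<Rightarrow> 'a \<Rightarrow> 'a"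
  where "transfer A f g =
    (\<Otimes>\<^bsub>G\<lparr>carrier := A\<rparr>\<^esub>C \<in> lcosets A. f (g \<otimes> (SOME x. x \<in> C)) \<otimes> inv (f (SOME x. x \<in> C)))"

text \<open>Representatives of \<open>C\<close> differ by a right factor in \<open>A\<close>, which
  passes through both values of \<open>f\<close> and cancels. Later computations thus replace the
  \<open>SOME\<close> representative by a convenient one.\<close>

lemma transfer_factor:
  assumes A: "subgroup A G" "comm_group (G\<lparr>carrier := A\<rparr>)"
    and f: "f \<in> carrier G \<rightarrow> A"
    and f_mult: "\<And>x c. x \<in> carrier G \<Longrightarrow> c \<in> A \<Longrightarrow> f (x \<otimes> c) = f x \<otimes> c"
    and C: "C \<in> lcosets A" "x \<in> C" and g: "g \<in> carrier G"
  shows "f (g \<otimes> (SOME x. x \<in> C)) \<otimes> inv (f (SOME x. x \<in> C)) = f (g \<otimes> x) \<otimes> inv (f x)"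
proof -
  interpret A: comm_group "G\<lparr>carrier := A\<rparr>" by fact
  define y where "y = (SOME x. x \<in> C)"
  have "y \<in> C" using C(2) unfolding y_def by (rule someI)
  have xy: "x \<in> carrier G" "y \<in> carrier G"
    using subgroup.lcosets_carrier[OF A(1) is_group C(1)] C(2) \<open>y \<in> C\<close> by auto
  from C(1) obtain z where z: "z \<in> carrier G" "C = z <# A" by (auto simp: LCOSETS_def)
  have "C = x <# A"
    using l_repr_independence[of x z A] z C(2) A(1) by simp
  then obtain c where c: "c \<in> A" "y = x \<otimes> c" "c \<in> carrier G"
    using \<open>y \<in> C\<close> subgroup.mem_carrier[OF A(1)] by (auto simp: l_coset_def)
  have fA: "f (g \<otimes> x) \<in> A" "f x \<in> A" using f g xy by auto
  then have fc: "f (g \<otimes> x) \<in> carrier G" "f x \<in> carrier G"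
    using subgroup.mem_carrier[OF A(1)] by auto
  have "f (g \<otimes> y) \<otimes> inv (f y) = f (g \<otimes> x) \<otimes> c \<otimes> (inv c \<otimes> inv (f x))"
    using fc f_mult[of "g \<otimes> x" c] f_mult[of x c] c g xy
    by (simp add: m_assoc inv_mult_group)
  also have "\<dots> = f (g \<otimes> x) \<otimes> inv (f x)"
    using fc c by (metis inv_closed m_assoc m_closed r_cancel_one' r_inv)
  finally show ?thesis unfolding y_def .
qed

text \<open>The factors satisfy a cocycle identity. Commutativity of \<open>A\<close> splits the
  product in two, and left multiplication by \<open>h\<close> permutes the cosets, which reindexes
  the first part.\<close>

lemma transfer_hom:
  assumes A: "subgroup A G" "comm_group (G\<lparr>carrier := A\<rparr>)"
    and f: "f \<in> carrier G \<rightarrow> A"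
    and f_mult: "\<And>x c. x \<in> carrier G \<Longrightarrow> c \<in> A \<Longrightarrow> f (x \<otimes> c) = f x \<otimes> c"
  shows "transfer A f \<in> hom G (G\<lparr>carrier := A\<rparr>)"
proof -
  interpret A: comm_group "G\<lparr>carrier := A\<rparr>" by fact
  interpret act: group_action G "lcosets A" "\<lambda>g. \<lambda>C \<in> lcosets A. g <# C"
    by (rule action_on_lcosets[OF A(1)])
  let ?d = "\<lambda>g C. f (g \<otimes> (SOME x. x \<in> C)) \<otimes> inv (f (SOME x. x \<in> C))"
  have nonempty: "\<exists>x. x \<in> C \<and> x \<in> carrier G" if "C \<in> lcosets A" for C
    using that lcos_self[OF _ A(1)] by (auto simp: LCOSETS_def)
  have d: "?d g C \<in> A" if "g \<in> carrier G" "C \<in> lcosets A" for g C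
  proof -
    obtain x where x: "x \<in> C" "x \<in> carrier G" using nonempty \<open>C \<in> lcosets A\<close> by blast
    have "f (g \<otimes> x) \<otimes> inv (f x) \<in> A"
      using x that f A(1) by (intro subgroup.m_closed subgroup.m_inv_closed) auto
    then show ?thesis
      using transfer_factor[OF A f f_mult that(2) x(1) that(1)] by simp
  qed
  \<comment> \<open>If \<open>x\<close> represents \<open>C\<close>, then
    \<open>h \<otimes> x\<close> represents \<open>h <# C\<close>, and the two terms
    \<open>f (h \<otimes> x)\<close> cancel.\<close>
  have mult: "?d (g \<otimes> h) C = ?d g (h <# C) \<otimes> ?d h C"
    if g: "g \<in> carrier G" and h: "h \<in> carrier G" and C: "C \<in> lcosets A" for g h C
  proof -
    obtain x where x: "x \<in> C" "x \<in> carrier G" using nonempty[OF C] by blast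
    have hC: "h <# C \<in> lcosets A" "h \<otimes> x \<in> h <# C"
      using act.element_image[OF h C] C x by (auto simp: l_coset_def)
    have fc: "f (g \<otimes> (h \<otimes> x)) \<in> carrier G" "f (h \<otimes> x) \<in> carrier G" "f x \<in> carrier G"
      using f g h x subgroup.subset[OF A(1)] by (auto simp: Pi_iff)
    have "?d (g \<otimes> h) C = f (g \<otimes> h \<otimes> x) \<otimes> inv (f x)"
      using g h C x by (intro transfer_factor[OF A f f_mult]) auto
    moreover have "?d g (h <# C) = f (g \<otimes> (h \<otimes> x)) \<otimes> inv (f (h \<otimes> x))"
      using g hC by (intro transfer_factor[OF A f f_mult]) auto
    moreover have "?d h C = f (h \<otimes> x) \<otimes> inv (f x)"
      using h C x by (intro transfer_factor[OF A f f_mult]) auto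
    ultimately show ?thesis
      using fc g h x by (simp add: m_assoc) (simp add: m_assoc[symmetric])
  qed
  show ?thesis
  proof (rule homI)
    fix g assume "g \<in> carrier G"
    then show "transfer A f g \<in> carrier (G\<lparr>carrier := A\<rparr>)"
      unfolding transfer_def using d by (intro A.finprod_closed) auto
  next
    fix g h assume g: "g \<in> carrier G" and h: "h \<in> carrier G"
    have bij: "inj_on (\<lambda>C. h <# C) (lcosets A)" "(\<lambda>C. h <# C) ` (lcosets A) = lcosets A"
      using act.inj_prop[OF h] act.surj_prop[OF h] by (auto simp: inj_on_def)
    then have hC: "h <# C \<in> lcosets A" if "C \<in> lcosets A" for C
      using that by blast
    have dd: "?d g (h <# C) \<otimes> ?d h C \<in> A" if "C \<in> lcosets A" for C
      using subgroup.m_closed[OF A(1) d[OF g hC[OF that]] d[OF h that]] .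
    have "transfer A f (g \<otimes> h) =
        (\<Otimes>\<^bsub>G\<lparr>carrier := A\<rparr>\<^esub>C \<in> lcosets A. ?d g (h <# C) \<otimes>\<^bsub>G\<lparr>carrier := A\<rparr>\<^esub> ?d h C)"
      unfolding transfer_def using dd mult[OF g h] by (intro A.finprod_cong') auto
    also have "\<dots> = (\<Otimes>\<^bsub>G\<lparr>carrier := A\<rparr>\<^esub>C \<in> lcosets A. ?d g (h <# C)) \<otimes> transfer A f h"
      unfolding transfer_def using d[OF g hC] d[OF h] by (subst A.finprod_multf) auto
    also have "(\<Otimes>\<^bsub>G\<lparr>carrier := A\<rparr>\<^esub>C \<in> lcosets A. ?d g (h <# C)) = transfer A f g"
      unfolding transfer_def using A.finprod_reindex[of "?d g" "\<lambda>C. h <# C" "lcosets A"] bij d[OF g]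
      by auto
    finally show "transfer A f (g \<otimes> h) = transfer A f g \<otimes>\<^bsub>G\<lparr>carrier := A\<rparr>\<^esub> transfer A f h"
      by simp
  qed
qed

section \<open>Malnormal subgroups and normal complements\<close>

lemma inv_mult_cancel:
  assumes "x \<in> carrier G" "y \<in> carrier G"
  shows "inv x \<otimes> (x \<otimes> y) = y" "x \<otimes> (inv x \<otimes> y) = y"
  using assms by (simp_all add: m_assoc[symmetric])

lemmas word_simps = m_assoc inv_mult_group inv_mult_cancel

definition malnormal :: "'a set \<Rightarrow> bool"
  where "malnormal A \<longleftrightarrow> subgroup A G \<and>
    (\<forall>x \<in> carrier G - A. \<forall>a \<in> A. inv x \<otimes> a \<otimes> x \<in> A \<longrightarrow> a = \<one>)"

text \<open>
  \<open>A\<close> acts freely on its nontrivial left cosets, so the transversal can be chosen invariant under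
  left multiplication by \<open>A\<close> outside \<open>A\<close>; with this choice the transfer of an element of \<open>A\<close> has only one
  nontrivial factor.
\<close>

lemma equivariant_retraction:
  assumes mal: "malnormal A"
  obtains f where "f \<in> carrier G \<rightarrow> A" "\<And>a. a \<in> A \<Longrightarrow> f a = a"
    "\<And>x c. x \<in> carrier G \<Longrightarrow> c \<in> A \<Longrightarrow> f (x \<otimes> c) = f x \<otimes> c"
    "\<And>b x. b \<in> A \<Longrightarrow> x \<in> carrier G - A \<Longrightarrow> f (b \<otimes> x) = f x"
proof -
  have A: "subgroup A G"
    and TI: "\<And>x a. x \<in> carrier G - A \<Longrightarrow> a \<in> A \<Longrightarrow> inv x \<otimes> a \<otimes> x \<in> A \<Longrightarrow> a = \<one>"
    using mal by (auto simp: malnormal_def)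
  note mem [simp] = subgroup.mem_carrier[OF A] subgroup.m_closed[OF A] subgroup.m_inv_closed[OF A]
    subgroup.one_closed[OF A]
  \<comment> \<open>\<open>D g\<close> is the double coset of \<open>g\<close> modulo
    \<open>A\<close> on both sides; \<open>\<rho>\<close> selects one representative per double
    coset.\<close>
  define D where "D g = {b \<otimes> g \<otimes> c | b c. b \<in> A \<and> c \<in> A}" for g
  have D_subset: "D (b \<otimes> g \<otimes> c) \<subseteq> D g" if bc: "b \<in> A" "c \<in> A" and g: "g \<in> carrier G" for b c g
  proof
    fix y assume "y \<in> D (b \<otimes> g \<otimes> c)"
    then obtain b' c' where y: "b' \<in> A" "c' \<in> A" "y = b' \<otimes> (b \<otimes> g \<otimes> c) \<otimes> c'"
      by (auto simp: D_def)
    have "y = (b' \<otimes> b) \<otimes> g \<otimes> (c \<otimes> c')" using y bc g by (simp add: m_assoc)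
    then show "y \<in> D g" using y(1,2) bc mem(2) unfolding D_def by blast
  qed
  have D_eq: "D (b \<otimes> g \<otimes> c) = D g" if bc: "b \<in> A" "c \<in> A" and g: "g \<in> carrier G" for b c g
  proof -
    have "D (inv b \<otimes> (b \<otimes> g \<otimes> c) \<otimes> inv c) \<subseteq> D (b \<otimes> g \<otimes> c)"
      using bc g by (intro D_subset) auto
    moreover have "inv b \<otimes> (b \<otimes> g \<otimes> c) \<otimes> inv c = g" using bc g by (simp add: word_simps)
    ultimately show ?thesis using D_subset[OF bc g] by auto
  qed
  define \<rho> where "\<rho> g = (SOME y. y \<in> D g)" for g
  have \<rho>_eq: "\<rho> (b \<otimes> g \<otimes> c) = \<rho> g" if "b \<in> A" "c \<in> A" "g \<in> carrier G" for b c g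
    using D_eq[OF that] by (simp add: \<rho>_def)
  have decomp: "\<exists>b c. b \<in> A \<and> c \<in> A \<and> g = b \<otimes> \<rho> g \<otimes> c" and \<rho>: "\<rho> g \<in> carrier G"
    if g: "g \<in> carrier G" for g
  proof -
    have "\<one> \<otimes> g \<otimes> \<one> \<in> D g" using mem(4) unfolding D_def by blast
    then have "\<rho> g \<in> D g" unfolding \<rho>_def by (rule someI)
    then obtain b c where bc: "b \<in> A" "c \<in> A" "\<rho> g = b \<otimes> g \<otimes> c" by (auto simp: D_def)
    then have "g = inv b \<otimes> \<rho> g \<otimes> inv c" using g by (simp add: word_simps)
    then show "\<exists>b c. b \<in> A \<and> c \<in> A \<and> g = b \<otimes> \<rho> g \<otimes> c" using bc(1,2) by (metis mem(3))
    show "\<rho> g \<in> carrier G" using bc g by simp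
  qed
  \<comment> \<open>Outside \<open>A\<close> the value is the right factor of \<open>g\<close>
    relative to the chosen representative. Inside \<open>A\<close> malnormality gives no uniqueness
    of that factor, so \<open>f\<close> is set to the identity there.\<close>
  define f where "f g = (if g \<in> A then g else THE c. c \<in> A \<and> (\<exists>b\<in>A. g = b \<otimes> \<rho> g \<otimes> c))" for g
  have f_eq: "f g = c" if g: "g \<in> carrier G - A" "g = b \<otimes> \<rho> g \<otimes> c" and bc: "b \<in> A" "c \<in> A" for g b c
  proof -
    have \<rho>g: "\<rho> g \<in> carrier G - A" using g bc \<rho>[of g] by (metis DiffD1 DiffD2 DiffI mem(2))
    \<comment> \<open>Equating two decompositions shows that conjugation by \<open>\<rho> g\<close>
      keeps \<open>inv b' \<otimes> b\<close> in \<open>A\<close>. As \<open>\<rho> g\<close> is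
      outside \<open>A\<close>, malnormality makes this element trivial.\<close>
    have "c' = c" if c': "c' \<in> A" "b' \<in> A" "g = b' \<otimes> \<rho> g \<otimes> c'" for c' b'
    proof -
      have "b \<otimes> \<rho> g \<otimes> c = b' \<otimes> \<rho> g \<otimes> c'" using g(2) c'(3) by simp
      then have "inv b' \<otimes> (b \<otimes> \<rho> g \<otimes> c) \<otimes> inv c = inv b' \<otimes> (b' \<otimes> \<rho> g \<otimes> c') \<otimes> inv c" by simp
      then have *: "inv b' \<otimes> b \<otimes> \<rho> g = \<rho> g \<otimes> (c' \<otimes> inv c)"
        using c'(1,2) bc \<rho>g by (simp add: word_simps)
      have "inv (\<rho> g) \<otimes> (inv b' \<otimes> b) \<otimes> \<rho> g = inv (\<rho> g) \<otimes> (inv b' \<otimes> b \<otimes> \<rho> g)"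
        using c'(1,2) bc \<rho>g by (simp add: m_assoc)
      also have "\<dots> = c' \<otimes> inv c" unfolding * using c'(1,2) bc \<rho>g by (simp add: word_simps)
      finally have **: "inv (\<rho> g) \<otimes> (inv b' \<otimes> b) \<otimes> \<rho> g = c' \<otimes> inv c" .
      then have "inv b' \<otimes> b = \<one>" using c'(1,2) bc by (intro TI[OF \<rho>g]) auto
      then have "c' \<otimes> inv c = \<one>" using ** \<rho>g by simp
      then show "c' = c" using c'(1) bc by (metis inv_closed inv_equality inv_inv mem(1))
    qed
    then have "(THE c. c \<in> A \<and> (\<exists>b\<in>A. g = b \<otimes> \<rho> g \<otimes> c)) = c"
      using g(2) bc by (intro the_equality) blast+
    then show ?thesis using g(1) by (simp add: f_def)
  qed
  have f_coset: "f (b \<otimes> x \<otimes> c) = f x \<otimes> c" and f_in: "f x \<in> A"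
    if x: "x \<in> carrier G - A" and bc: "b \<in> A" "c \<in> A" for b x c
  proof -
    from decomp[of x] x obtain b' c' where x': "b' \<in> A" "c' \<in> A" "x = b' \<otimes> \<rho> x \<otimes> c'" by auto
    have fx: "f x = c'" using f_eq[OF x x'(3,1,2)] .
    then show "f x \<in> A" using x' by simp
    have "b \<otimes> x \<otimes> c \<notin> A"
    proof
      assume "b \<otimes> x \<otimes> c \<in> A"
      then have "inv b \<otimes> (b \<otimes> x \<otimes> c) \<otimes> inv c \<in> A" using bc by simp
      then show False using bc x by (simp add: word_simps)
    qed
    moreover have "b \<otimes> x \<otimes> c = (b \<otimes> b') \<otimes> \<rho> (b \<otimes> x \<otimes> c) \<otimes> (c' \<otimes> c)"
    proof -
      have "b \<otimes> x \<otimes> c = b \<otimes> (b' \<otimes> \<rho> x \<otimes> c') \<otimes> c" using x'(3) by simp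
      also have "\<dots> = (b \<otimes> b') \<otimes> \<rho> x \<otimes> (c' \<otimes> c)" using x x'(1,2) bc \<rho>[of x] by (simp add: m_assoc)
      finally show ?thesis unfolding \<rho>_eq[OF bc DiffD1[OF x]] .
    qed
    ultimately have "f (b \<otimes> x \<otimes> c) = c' \<otimes> c"
      using x x'(1,2) bc by (intro f_eq[where b = "b \<otimes> b'"]) auto
    then show "f (b \<otimes> x \<otimes> c) = f x \<otimes> c" using fx by simp
  qed
  show thesis
  proof
    show "f \<in> carrier G \<rightarrow> A" using f_in[OF _ mem(4) mem(4)] by (auto simp: f_def)
    show fa: "f a = a" if "a \<in> A" for a using that by (simp add: f_def)
    show "f (x \<otimes> c) = f x \<otimes> c" if "x \<in> carrier G" "c \<in> A" for x c
      using that fa f_coset[of x \<one> c] by (cases "x \<in> A") auto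
    show "f (b \<otimes> x) = f x" if "b \<in> A" "x \<in> carrier G - A" for b x
      using that f_coset[of x b \<one>] f_in[of x \<one> \<one>] by auto
  qed
qed

text \<open>The transfer fixes \<open>A\<close> pointwise, so its kernel meets \<open>A\<close>
  trivially and each \<open>g\<close> is \<open>g \<otimes> inv (?V g)\<close>, which lies in the
  kernel, times \<open>?V g\<close> in \<open>A\<close>.\<close>

lemma frobenius_kernel_exists:
  assumes fin: "finite (carrier G)"
    and mal: "malnormal A" and comm: "comm_group (G\<lparr>carrier := A\<rparr>)"
  obtains N where "N \<lhd> G" "N \<inter> A = {\<one>}" "N <#> A = carrier G"
proof -
  have A: "subgroup A G" "comm_group (G\<lparr>carrier := A\<rparr>)"
    using mal comm by (auto simp: malnormal_def)
  obtain f where f: "f \<in> carrier G \<rightarrow> A" "\<And>a. a \<in> A \<Longrightarrow> f a = a"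
    "\<And>x c. x \<in> carrier G \<Longrightarrow> c \<in> A \<Longrightarrow> f (x \<otimes> c) = f x \<otimes> c"
    "\<And>b x. b \<in> A \<Longrightarrow> x \<in> carrier G - A \<Longrightarrow> f (b \<otimes> x) = f x"
    using equivariant_retraction[OF mal] by blast
  interpret A: comm_group "G\<lparr>carrier := A\<rparr>" by fact
  let ?V = "transfer A f"
  interpret V: group_hom G "G\<lparr>carrier := A\<rparr>" ?V
    by unfold_locales (rule transfer_hom[OF A f(1,3)])
  have carr: "x \<in> carrier G" if "x \<in> A" for x using that subgroup.mem_carrier[OF A(1)] by simp
  have one: "\<one> \<in> A" using subgroup.one_closed[OF A(1)] .
  have A_coset: "A \<in> lcosets A"
    using lcos_mult_one[OF subgroup.subset[OF A(1)]] by (force simp: LCOSETS_def)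
  have fincos: "finite (lcosets A)"
    using lcosets_subset_PowG[OF A(1)] fin finite_subset by blast
  \<comment> \<open>On the coset \<open>A\<close> the representative \<open>\<one>\<close> gives the
    factor \<open>a\<close>; on any other coset \<open>f (a \<otimes> x) = f x\<close> makes the
    factor trivial.\<close>
  have V_A: "?V a = a" if a: "a \<in> A" for a
  proof -
    let ?d = "\<lambda>C. f (a \<otimes> (SOME x. x \<in> C)) \<otimes> inv (f (SOME x. x \<in> C))"
    have dA: "?d A = a"
      using transfer_factor[OF A f(1,3) A_coset one carr[OF a]] a carr one f(2) by simp
    have d1: "?d C = \<one>" if C: "C \<in> lcosets A" "A \<noteq> C" for C
    proof -
      obtain x where x: "x \<in> C" "x \<in> carrier G"
        using C lcos_self[OF _ A(1)] by (auto simp: LCOSETS_def)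
      then have "x \<notin> A" using lcos_disjoint[OF A(1) A_coset C] by blast
      then have "f (a \<otimes> x) \<otimes> inv (f x) = \<one>"
        using f(1,4) a x carr by (auto simp: Pi_iff)
      then show ?thesis
        using transfer_factor[OF A f(1,3) C(1) x(1) carr[OF a]] by simp
    qed
    have dmem: "?d C \<in> A" if "C \<in> lcosets A" for C
      using that dA d1 a one by (cases "A = C") auto
    have "?V a = (\<Otimes>\<^bsub>G\<lparr>carrier := A\<rparr>\<^esub>C \<in> lcosets A. if A = C then ?d C else \<one>\<^bsub>G\<lparr>carrier := A\<rparr>\<^esub>)"
      unfolding transfer_def using dmem d1 one by (intro A.finprod_cong') auto
    also have "\<dots> = ?d A"
      using A_coset fincos dmem by (intro A.finprod_singleton) auto
    finally show ?thesis using dA by simp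
  qed
  let ?N = "kernel G (G\<lparr>carrier := A\<rparr>) ?V"
  have "?N \<inter> A = {\<one>}" using V_A one by (auto simp: kernel_def)
  moreover have "g \<in> ?N <#> A" if g: "g \<in> carrier G" for g
  proof -
    have Vg: "?V g \<in> A" "?V g \<in> carrier G" using V.hom_closed[OF g] carr by auto
    have "?V (g \<otimes> inv (?V g)) = ?V g \<otimes> ?V (inv (?V g))"
      using V.hom_mult[OF g, of "inv (?V g)"] Vg by simp
    also have "\<dots> = \<one>"
      using Vg V_A[of "inv (?V g)"] subgroup.m_inv_closed[OF A(1)] by simp
    finally have "g \<otimes> inv (?V g) \<in> ?N" using g Vg by (simp add: kernel_def)
    moreover have "g = (g \<otimes> inv (?V g)) \<otimes> ?V g" using g Vg by (simp add: m_assoc)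
    ultimately show ?thesis using Vg(1) unfolding set_mult_def by blast
  qed
  then have "?N <#> A = carrier G"
    using setmult_subset_G[OF subgroup.subset[OF V.subgroup_kernel] subgroup.subset[OF A(1)]] by blast
  ultimately show thesis using that V.normal_kernel by blast
qed

end

section \<open>Maximal cyclic subgroups\<close>

context group
begin

lemma comm_group_generate_singleton:
  assumes "a \<in> carrier G"
  shows "comm_group (G\<lparr>carrier := generate G {a}\<rparr>)"
proof -
  interpret A: group "G\<lparr>carrier := generate G {a}\<rparr>"
    using assms by (intro subgroup_imp_group generate_is_subgroup) auto
  show ?thesis
    using assms generate_pow[OF assms]
    by (intro A.group_comm_groupI) (auto simp: int_pow_mult[symmetric] add.commute)
qed

section \<open>Conjugation and normalisers\<close>

lemma mem_normalizer_iff: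
  assumes "P \<subseteq> carrier G" and g: "g \<in> carrier G"
  shows "g \<in> normalizer G P \<longleftrightarrow> (\<lambda>u. g \<otimes> u \<otimes> inv g) ` P = P"
proof -
  have "g <# P #> inv g = (\<lambda>u. g \<otimes> u \<otimes> inv g) ` P"
    by (auto simp: l_coset_def r_coset_def)
  then show ?thesis
    using assms by (simp add: normalizer_def stabilizer_def)
qed

lemma inj_on_conjugation:
  assumes "P \<subseteq> carrier G" "g \<in> carrier G"
  shows "inj_on (\<lambda>u. g \<otimes> u \<otimes> inv g) P"
  using assms by (auto simp: inj_on_def subset_iff)

text \<open>Conjugation is injective, so on a finite set inclusion already forces equality.\<close>

lemma mem_normalizerI:
  assumes "P \<subseteq> carrier G" "finite P" "g \<in> carrier G" "\<And>u. u \<in> P \<Longrightarrow> g \<otimes> u \<otimes> inv g \<in> P"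
  shows "g \<in> normalizer G P"
  using assms inj_on_conjugation[OF assms(1,3)]
  by (simp add: mem_normalizer_iff endo_inj_surj image_subset_iff)

text \<open>The normaliser of \<open>P\<close> contains \<open>A\<close> and \<open>P\<close>, so
  maximality makes \<open>P\<close> normal. Then \<open>P <#> A\<close> is a subgroup containing
  both, and maximality applies again.\<close>

lemma set_mult_maximal_eq_carrier:
  assumes P: "subgroup P G" and A: "subgroup A G" and "A \<subseteq> normalizer G P" and "\<not> P \<subseteq> A"
    and max: "\<And>H. subgroup H G \<Longrightarrow> A \<subseteq> H \<Longrightarrow> H = A \<or> H = carrier G"
  shows "P <#> A = carrier G"
proof -
  have P_sub: "P \<subseteq> carrier G" using subgroup.subset[OF P] .
  have norm: "subgroup (normalizer G P) G" using normalizer_imp_subgroup[OF P_sub] .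
  have "P \<subseteq> normalizer G P"
  proof
    fix g assume g: "g \<in> P"
    have "(\<lambda>u. g \<otimes> u \<otimes> inv g) ` P = P"
    proof (intro equalityI subsetI)
      fix u assume u: "u \<in> P"
      have "u = g \<otimes> (inv g \<otimes> u \<otimes> g) \<otimes> inv g"
        using u g P_sub by (simp add: word_simps subset_iff)
      moreover have "inv g \<otimes> u \<otimes> g \<in> P"
        using u g P by (simp add: subgroup.m_closed subgroup.m_inv_closed)
      ultimately show "u \<in> (\<lambda>u. g \<otimes> u \<otimes> inv g) ` P" by blast
    qed (use g P in \<open>auto simp: subgroup.m_closed subgroup.m_inv_closed\<close>)
    then show "g \<in> normalizer G P" using g P_sub mem_normalizer_iff[OF P_sub] by blast
  qed
  then have all: "normalizer G P = carrier G"
    using max[OF norm] assms(3,4) by auto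
  have "g \<otimes> u \<otimes> inv g \<in> P" if "g \<in> carrier G" "u \<in> P" for g u
    using that all mem_normalizer_iff[OF P_sub that(1)] by blast
  then have "P \<lhd> G"
    using P by (simp add: normal_inv_iff)
  then interpret second_isomorphism_grp P G A
    using A by (simp add: second_isomorphism_grp_def second_isomorphism_grp_axioms_def)
  show ?thesis
    using max[OF normal_set_mult_subgroup S_contained_in_set_mult] H_contained_in_set_mult assms(4)
    by auto
qed

text \<open>Conjugation by \<open>a\<close> has no nontrivial fixed point in \<open>N\<close>, so \<open>y \<mapsto> y a y\<^sup>-\<^sup>1 a\<^sup>-\<^sup>1\<close> permutes \<open>N\<close>.\<close>

lemma frobenius_kernel_coset:
  assumes fin: "finite (carrier G)" and N: "N \<lhd> G" "N \<inter> A = {\<one>}"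
    and mal: "malnormal A" and a: "a \<in> A" "a \<noteq> \<one>" and n: "n \<in> N"
  obtains y where "y \<in> N" "y \<otimes> a \<otimes> inv y = n \<otimes> a"
proof -
  interpret N: normal N G by fact
  have A: "subgroup A G" and TI: "\<And>x a. x \<in> carrier G - A \<Longrightarrow> a \<in> A \<Longrightarrow> inv x \<otimes> a \<otimes> x \<in> A \<Longrightarrow> a = \<one>"
    using mal by (auto simp: malnormal_def)
  have ac: "a \<in> carrier G" using subgroup.mem_carrier[OF A a(1)] .
  let ?\<psi> = "\<lambda>y. y \<otimes> a \<otimes> inv y \<otimes> inv a"
  have "inj_on ?\<psi> N"
  proof (rule inj_onI)
    fix y z assume yz: "y \<in> N" "z \<in> N" "?\<psi> y = ?\<psi> z"
    \<comment> \<open>Equal values make \<open>?w\<close> commute with \<open>a\<close>; as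
      \<open>a \<noteq> \<one>\<close>, malnormality places \<open>?w\<close> in \<open>A\<close>,
      hence in \<open>N \<inter> A\<close>.\<close>
    let ?w = "inv y \<otimes> z"
    have "inv y \<otimes> (?\<psi> y \<otimes> a) \<otimes> z = inv y \<otimes> (?\<psi> z \<otimes> a) \<otimes> z" using yz(3) by simp
    then have "a \<otimes> ?w = ?w \<otimes> a" using yz(1,2) ac by (simp add: word_simps)
    then have "inv ?w \<otimes> a \<otimes> ?w = a" using yz(1,2) ac by (simp add: word_simps)
    then have "?w \<in> A" using TI[of ?w a] a yz(1,2) by auto
    then have "?w = \<one>" using N(2) yz(1,2) by (metis IntI N.m_closed N.m_inv_closed singletonD)
    then show "y = z" using yz(1,2) by (metis N.mem_carrier inv_closed inv_equality inv_inv)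
  qed
  moreover have "?\<psi> ` N \<subseteq> N"
  proof clarify
    fix y assume y: "y \<in> N"
    have "?\<psi> y = y \<otimes> (a \<otimes> inv y \<otimes> inv a)" using y ac by (simp add: m_assoc)
    also have "\<dots> \<in> N" using y ac by (intro N.m_closed N.inv_op_closed2) auto
    finally show "?\<psi> y \<in> N" .
  qed
  ultimately have "?\<psi> ` N = N"
    using fin finite_subset[OF N.subset] by (simp add: endo_inj_surj)
  then have "n \<in> ?\<psi> ` N" using n by simp
  then obtain y where y: "n = ?\<psi> y" "y \<in> N" by (rule imageE)
  then have "y \<otimes> a \<otimes> inv y = n \<otimes> a" using ac by (simp add: m_assoc)
  then show thesis using that y(2) by blast
qed

text \<open>A Frattini-style argument. Sylow conjugacy in \<open>N\<close> gives \<open>x\<close> in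
  \<open>N\<close> such that \<open>inv x \<otimes> a\<close> normalises \<open>P\<close>. For
  \<open>a \<noteq> \<one>\<close> this element is \<open>y \<otimes> a \<otimes> inv y\<close> for
  some \<open>y\<close> in \<open>N\<close>, so \<open>a\<close> normalises the conjugate
  \<open>?R\<close> of \<open>P\<close>.\<close>

lemma invariant_sylow_subgroup:
  assumes fin: "finite (carrier G)" and N: "N \<lhd> G" "N \<inter> A = {\<one>}"
    and mal: "malnormal A" and a: "a \<in> A" and p: "Factorial_Ring.prime p" "p dvd card N"
  obtains P k where "subgroup P G" "P \<subseteq> N" "card P = p ^ k" "k > 0" "a \<in> normalizer G P"
proof -
  interpret N: normal N G by fact
  interpret NG: group "G\<lparr>carrier := N\<rparr>" by (rule subgroup_imp_group[OF N.subgroup_axioms])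
  have ac: "a \<in> carrier G" using a mal subgroup.mem_carrier by (auto simp: malnormal_def)
  have finN: "finite N" using fin N.subset finite_subset by blast
  then have "card N \<noteq> 0" using N.one_closed by (metis card_0_eq empty_iff)
  define k where "k = multiplicity p (card N)"
  obtain m where m: "card N = p ^ k * m" "\<not> p dvd m"
    unfolding k_def using multiplicity_decompose'[OF \<open>card N \<noteq> 0\<close>, of p] p(1)
    by (auto simp: prime_nat_iff)
  have "k > 0" using m p(2) by (cases k) auto
  obtain P where P: "subgroup P (G\<lparr>carrier := N\<rparr>)" "card P = p ^ k"
    using sylow_thm[of p "G\<lparr>carrier := N\<rparr>" k m] p(1) m(1) finN NG.is_group by (auto simp: order_def)
  have P_N: "P \<subseteq> N" using subgroup.subset[OF P(1)] by simp
  have PG: "subgroup P G" using incl_subgroup[OF N.subgroup_axioms P(1)] .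
  have P_sub: "P \<subseteq> carrier G" using subgroup.subset[OF PG] .
  let ?Q = "a <# P #> inv a"
  have Q_eq: "?Q = (\<lambda>u. a \<otimes> u \<otimes> inv a) ` P" by (auto simp: l_coset_def r_coset_def)
  have cardQ: "card ?Q = p ^ k"
    unfolding Q_eq using P(2) inj_on_conjugation[OF P_sub ac] by (simp add: card_image)
  have "?Q \<subseteq> N" unfolding Q_eq using P_N N.inv_op_closed2[OF ac] by auto
  then have Q: "subgroup ?Q (G\<lparr>carrier := N\<rparr>)"
    using subgroup_conjugation_is_surj2[OF ac PG] N.subgroup_axioms by (intro subgroup_incl)
  have "card (lcosets\<^bsub>G\<lparr>carrier := N\<rparr>\<^esub> P) * p ^ k = p ^ k * m"
    using NG.l_lagrange[OF _ P(1)] finN P(2) m(1) by (simp add: order_def)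
  then have index: "\<not> p dvd card (lcosets\<^bsub>G\<lparr>carrier := N\<rparr>\<^esub> P)"
    using m(2) p(1) by simp
  have "finite (carrier (G\<lparr>carrier := N\<rparr>))" using finN by simp
  then obtain x where x: "x \<in> carrier (G\<lparr>carrier := N\<rparr>)"
      "\<And>q. q \<in> ?Q \<Longrightarrow> inv\<^bsub>G\<lparr>carrier := N\<rparr>\<^esub> x \<otimes>\<^bsub>G\<lparr>carrier := N\<rparr>\<^esub> q \<otimes>\<^bsub>G\<lparr>carrier := N\<rparr>\<^esub> x \<in> P"
    using NG.p_subgroup_in_conjugate_of_sylow[OF _ P(1) Q p(1) cardQ index] by blast
  then have x: "x \<in> N" "\<And>q. q \<in> ?Q \<Longrightarrow> inv x \<otimes> q \<otimes> x \<in> P"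
    using m_inv_consistent[OF N.subgroup_axioms] by auto
  \<comment> \<open>For \<open>a = \<one>\<close> the choice \<open>y = \<one>\<close> is made
    separately, since \<open>frobenius_kernel_coset\<close> covers only
    \<open>a \<noteq> \<one>\<close>.\<close>
  obtain y where y: "y \<in> N" "\<And>v. v \<in> P \<Longrightarrow>
      (y \<otimes> a \<otimes> inv y) \<otimes> v \<otimes> inv (y \<otimes> a \<otimes> inv y) \<in> P"
  proof (cases "a = \<one>")
    case True
    then show thesis using that[of \<one>] P_sub by (auto simp: subset_iff)
  next
    case False
    then obtain y where y: "y \<in> N" "y \<otimes> a \<otimes> inv y = inv x \<otimes> a"
      using frobenius_kernel_coset[OF fin N mal a, of "inv x"] x(1) by auto
    have "(inv x \<otimes> a) \<otimes> v \<otimes> inv (inv x \<otimes> a) \<in> P" if v: "v \<in> P" for v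
    proof -
      have "inv x \<otimes> (a \<otimes> v \<otimes> inv a) \<otimes> x \<in> P" using x(2) v unfolding Q_eq by blast
      then show ?thesis using v P_sub ac x(1) by (simp add: word_simps subset_iff)
    qed
    then show thesis using that[OF y(1)] y(2) by simp
  qed
  let ?R = "inv y <# P #> y"
  have R_eq: "?R = (\<lambda>u. inv y \<otimes> u \<otimes> y) ` P" by (auto simp: l_coset_def r_coset_def)
  have yc: "y \<in> carrier G" using y(1) by simp
  have R: "subgroup ?R G" using subgroup_conjugation_is_surj1[OF yc PG] .
  have R_N: "?R \<subseteq> N" unfolding R_eq using P_N N.inv_op_closed1[OF yc] by auto
  have "card ?R = p ^ k"
    unfolding R_eq using P(2) inj_on_conjugation[OF P_sub, of "inv y"] yc by (simp add: card_image)
  moreover have "a \<in> normalizer G ?R"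
  proof (rule mem_normalizerI)
    show "finite ?R" using R_N finN finite_subset by blast
    fix u assume "u \<in> ?R"
    then obtain v where v: "v \<in> P" "u = inv y \<otimes> v \<otimes> y" unfolding R_eq by blast
    have "a \<otimes> u \<otimes> inv a = inv y \<otimes> ((y \<otimes> a \<otimes> inv y) \<otimes> v \<otimes> inv (y \<otimes> a \<otimes> inv y)) \<otimes> y"
      using v P_sub yc ac by (auto simp add: word_simps subset_iff)
    then show "a \<otimes> u \<otimes> inv a \<in> ?R" unfolding R_eq using y(2)[OF v(1)] by blast
  qed (use subgroup.subset[OF R] ac in auto)
  ultimately show thesis using that[OF R R_N _ \<open>k > 0\<close>] by blast
qed

text \<open>The case of trivial core. As \<open>?A\<close> is proper, some prime \<open>p\<close>
  divides \<open>card N\<close>. The invariant Sylow subgroup \<open>P\<close> meets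
  \<open>?A\<close> trivially, so it is not inside \<open>?A\<close>, and maximality yields a
  factorisation of the group as \<open>P <#> ?A\<close>.\<close>

lemma index_of_maximal_malnormal_cyclic:
  assumes fin: "finite (carrier G)" and a: "a \<in> carrier G"
    and mal: "malnormal (generate G {a})"
    and max: "\<And>H. subgroup H G \<Longrightarrow> generate G {a} \<subseteq> H \<Longrightarrow> H = generate G {a} \<or> H = carrier G"
    and proper: "generate G {a} \<noteq> carrier G"
  obtains p k where "Factorial_Ring.prime p" "k > 0" "order G = p ^ k * card (generate G {a})"
proof -
  let ?A = "generate G {a}"
  have A: "subgroup ?A G" using mal by (simp add: malnormal_def)
  have aA: "a \<in> ?A" by (simp add: generate.incl)
  obtain N where N: "N \<lhd> G" "N \<inter> ?A = {\<one>}" "N <#> ?A = carrier G"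
    using frobenius_kernel_exists[OF fin mal comm_group_generate_singleton[OF a]] .
  interpret N: normal N G by fact
  have "card N \<noteq> 1"
  proof
    assume "card N = 1"
    then have "N = {\<one>}" using N.one_closed by (metis card_1_singletonE singletonD)
    then have "carrier G = ?A"
      using N(3) subgroup.subset[OF A] by (auto simp: set_mult_def subset_iff)
    then show False using proper by simp
  qed
  then obtain p where p: "Factorial_Ring.prime p" "p dvd card N" using prime_factor_nat by blast
  obtain P k where P: "subgroup P G" "P \<subseteq> N" "card P = p ^ k" "k > 0" "a \<in> normalizer G P"
    using invariant_sylow_subgroup[OF fin N(1,2) mal aA p] .
  have inter: "P \<inter> ?A = {\<one>}" using P(1,2) N(2) A subgroup.one_closed by blast
  have "card P \<noteq> 1" using P(3,4) p(1) by (auto simp: prime_nat_iff)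
  then have "\<not> P \<subseteq> ?A" using inter by (auto simp: Int_absorb2)
  moreover have "?A \<subseteq> normalizer G P"
    using P(1,5) by (intro generate_subgroup_incl normalizer_imp_subgroup subgroup.subset) auto
  ultimately have "P <#> ?A = carrier G"
    using set_mult_maximal_eq_carrier[OF P(1) A _ _ max] by blast
  then have "order G = p ^ k * card ?A"
    using card_set_mult_trivial_inter[OF P(1) A inter] P(3) by (simp add: order_def)
  then show thesis using that p(1) P(4) by blast
qed

section \<open>The core and the quotient by it\<close>

lemma core_normal:
  assumes A: "subgroup A G"
  shows "{k \<in> A. \<forall>g \<in> carrier G. inv g \<otimes> k \<otimes> g \<in> A} \<lhd> G" (is "?K \<lhd> G")
proof -
  have carr: "x \<in> carrier G" if "x \<in> A" for x using that subgroup.mem_carrier[OF A] by simp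
  have "subgroup ?K G"
  proof (rule subgroupI)
    show "?K \<subseteq> carrier G" using carr by blast
    have "\<one> \<in> ?K" using subgroup.one_closed[OF A] by simp
    then show "?K \<noteq> {}" by blast
    fix k assume k: "k \<in> ?K"
    have "inv g \<otimes> inv k \<otimes> g = inv (inv g \<otimes> k \<otimes> g)" if "g \<in> carrier G" for g
      using that k carr by (simp add: word_simps)
    then show "inv k \<in> ?K" using k subgroup.m_inv_closed[OF A] by simp
    fix l assume l: "l \<in> ?K"
    have "inv g \<otimes> (k \<otimes> l) \<otimes> g = (inv g \<otimes> k \<otimes> g) \<otimes> (inv g \<otimes> l \<otimes> g)" if "g \<in> carrier G" for g
      using that k l carr by (simp add: word_simps)
    then show "k \<otimes> l \<in> ?K" using k l subgroup.m_closed[OF A] by simp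
  qed
  moreover have "x \<otimes> k \<otimes> inv x \<in> ?K" if x: "x \<in> carrier G" and k: "k \<in> ?K" for x k
  proof -
    \<comment> \<open>Conjugating by \<open>x\<close> only replaces \<open>g\<close> by
      \<open>inv x \<otimes> g\<close> in the condition that defines the core.\<close>
    have "inv g \<otimes> (x \<otimes> k \<otimes> inv x) \<otimes> g = inv (inv x \<otimes> g) \<otimes> k \<otimes> (inv x \<otimes> g)"
      if "g \<in> carrier G" for g
      using that x k carr by (simp add: word_simps)
    then have *: "inv g \<otimes> (x \<otimes> k \<otimes> inv x) \<otimes> g \<in> A" if "g \<in> carrier G" for g
      using that x k by simp
    moreover have "x \<otimes> k \<otimes> inv x \<in> A" using *[OF one_closed] x k carr by simp
    ultimately show ?thesis by simp
  qed
  ultimately show ?thesis by (simp add: normal_inv_iff)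
qed

text \<open>
  The centraliser of \<open>y\<close> contains \<open>A\<close>. If it is \<open>G\<close> then \<open>y\<close> is central; if it is \<open>A\<close> then \<open>x\<close>
  normalises \<open>A\<close>, so that \<open>A\<close> is normal.
\<close>

lemma maximal_inter_conjugate_in_core:
  assumes fin: "finite (carrier G)"
    and A: "subgroup A G" and comm: "\<And>x y. x \<in> A \<Longrightarrow> y \<in> A \<Longrightarrow> x \<otimes> y = y \<otimes> x"
    and max: "\<And>H. subgroup H G \<Longrightarrow> A \<subseteq> H \<Longrightarrow> H = A \<or> H = carrier G"
    and x: "x \<in> carrier G" "x \<notin> A" and y: "y \<in> A" "inv x \<otimes> y \<otimes> x \<in> A" and g: "g \<in> carrier G"
  shows "inv g \<otimes> y \<otimes> g \<in> A"
proof -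
  have carr: "x \<in> carrier G" if "x \<in> A" for x using that subgroup.mem_carrier[OF A] by simp
  let ?C = "{h \<in> carrier G. h \<otimes> y = y \<otimes> h}"
  have C: "subgroup ?C G"
  proof (rule subgroupI)
    fix h assume h: "h \<in> ?C"
    then have "inv h \<otimes> (h \<otimes> y) \<otimes> inv h = inv h \<otimes> (y \<otimes> h) \<otimes> inv h" by simp
    moreover have "h \<in> carrier G" using h by simp
    ultimately show "inv h \<in> ?C" using carr[OF y(1)] by (simp add: word_simps)
    fix k assume k: "k \<in> ?C"
    have "h \<otimes> k \<otimes> y = h \<otimes> (y \<otimes> k)" using h k carr[OF y(1)] by (simp add: m_assoc)
    also have "\<dots> = (y \<otimes> h) \<otimes> k" using h k carr[OF y(1)] by (simp add: m_assoc[symmetric])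
    finally show "h \<otimes> k \<in> ?C" using h k carr[OF y(1)] by (simp add: m_assoc)
  qed (use carr[OF y(1)] in auto)
  have "A \<subseteq> ?C" using carr comm[OF _ y(1)] by auto
  then consider "?C = carrier G" | "?C = A" using max[OF C] by blast
  then show ?thesis
  proof cases
    case 1
    then have "g \<otimes> y = y \<otimes> g" using g by blast
    then have "inv g \<otimes> y \<otimes> g = y" using g carr[OF y(1)]
      by (metis inv_closed inv_mult_cancel(1) m_assoc)
    then show ?thesis using y(1) by simp
  next
    case 2
    have A_sub: "A \<subseteq> carrier G" using subgroup.subset[OF A] .
    have finA: "finite A" using fin A_sub finite_subset by blast
    \<comment> \<open>Inside \<open>A\<close>, \<open>c\<close> commutes with
      \<open>inv x \<otimes> y \<otimes> x\<close>. Conjugating by \<open>x\<close>, the element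
      \<open>x \<otimes> c \<otimes> inv x\<close> commutes with \<open>y\<close>, so it lies in
      \<open>?C = A\<close>.\<close>
    have "x \<otimes> c \<otimes> inv x \<in> A" if c: "c \<in> A" for c
    proof -
      have "x \<otimes> (c \<otimes> (inv x \<otimes> y \<otimes> x)) \<otimes> inv x = x \<otimes> ((inv x \<otimes> y \<otimes> x) \<otimes> c) \<otimes> inv x"
        using comm[OF c y(2)] by simp
      then have "(x \<otimes> c \<otimes> inv x) \<otimes> y = y \<otimes> (x \<otimes> c \<otimes> inv x)"
        using x c carr carr[OF y(1)] by (simp add: word_simps)
      then show ?thesis using 2 x c carr by blast
    qed
    then have "x \<in> normalizer G A" using A_sub finA x by (intro mem_normalizerI)
    moreover have "A \<subseteq> normalizer G A"
    proof
      fix h assume h: "h \<in> A"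
      then show "h \<in> normalizer G A"
        using A A_sub finA carr by (intro mem_normalizerI)
          (auto intro!: subgroup.m_closed subgroup.m_inv_closed)
    qed
    ultimately have "normalizer G A = carrier G"
      using max[OF normalizer_imp_subgroup[OF A_sub]] x(2) by auto
    then have "(\<lambda>u. inv g \<otimes> u \<otimes> inv (inv g)) ` A = A"
      using g mem_normalizer_iff[OF A_sub, of "inv g"] by simp
    then show ?thesis using y(1) g by auto
  qed
qed

text \<open>Modulo the core \<open>K\<close> the image of \<open>?A\<close> is cyclic, maximal,
  proper and malnormal, so the case of trivial core applies. As \<open>K\<close> lies in
  \<open>?A\<close>, the index does not change.\<close>

theorem index_of_maximal_cyclic:
  assumes fin: "finite (carrier G)" and a: "a \<in> carrier G"
    and max: "\<And>H. subgroup H G \<Longrightarrow> generate G {a} \<subseteq> H \<Longrightarrow> H = generate G {a} \<or> H = carrier G"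
    and proper: "generate G {a} \<noteq> carrier G"
  obtains p k where "Factorial_Ring.prime p" "k > 0" "order G = p ^ k * card (generate G {a})"
proof -
  let ?A = "generate G {a}"
  have A: "subgroup ?A G" using a by (intro generate_is_subgroup) auto
  have A_sub: "?A \<subseteq> carrier G" using subgroup.subset[OF A] .
  interpret A: comm_group "G\<lparr>carrier := ?A\<rparr>" by (rule comm_group_generate_singleton[OF a])
  define K where "K = {k \<in> ?A. \<forall>g \<in> carrier G. inv g \<otimes> k \<otimes> g \<in> ?A}"
  interpret K: normal K G unfolding K_def by (rule core_normal[OF A])
  have K_A: "K \<subseteq> ?A" by (auto simp: K_def)
  interpret Q: group "G Mod K" by (rule K.factorgroup_is_group)
  interpret \<pi>: group_hom G "G Mod K" "\<lambda>x. K #> x"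
    by unfold_locales (rule K.r_coset_hom_Mod)
  have gen: "generate (G Mod K) {K #> a} = (\<lambda>x. K #> x) ` ?A"
    using \<pi>.generate_img[of "{a}"] a by simp
  \<comment> \<open>Since \<open>K\<close> is contained in \<open>?A\<close>, the subgroup
    \<open>?A\<close> is the full preimage of its image.\<close>
  have mem_A: "x \<in> ?A" if x: "x \<in> carrier G" "K #> x \<in> (\<lambda>x. K #> x) ` ?A" for x
  proof -
    obtain y where y: "K #> x = K #> y" "y \<in> ?A" using x(2) by (rule imageE)
    have "x \<in> K #> y" using rcos_self[OF x(1) K.subgroup_axioms] y(1) by simp
    then obtain k where "k \<in> K" "x = k \<otimes> y" by (auto simp: r_coset_def)
    then show ?thesis using K_A y(2) subgroup.m_closed[OF A] by auto
  qed
  have carrQ: "carrier (G Mod K) = (\<lambda>x. K #> x) ` carrier G" by (rule carrier_FactGroup)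
  \<comment> \<open>\<open>S\<close> and \<open>T\<close> lift to \<open>x\<close> outside
    \<open>?A\<close> and \<open>y\<close> in \<open>?A\<close> with
    \<open>inv x \<otimes> y \<otimes> x\<close> in \<open>?A\<close>. Maximality then puts
    \<open>y\<close> in every conjugate of \<open>?A\<close>, that is, in \<open>K\<close>.\<close>
  have mal: "group.malnormal (G Mod K) ((\<lambda>x. K #> x) ` ?A)"
    unfolding Q.malnormal_def
  proof (intro conjI ballI impI)
    show "subgroup ((\<lambda>x. K #> x) ` ?A) (G Mod K)" by (rule \<pi>.subgroup_img_is_subgroup[OF A])
    fix S T assume S: "S \<in> carrier (G Mod K) - (\<lambda>x. K #> x) ` ?A" and T: "T \<in> (\<lambda>x. K #> x) ` ?A"
      and STS: "inv\<^bsub>G Mod K\<^esub> S \<otimes>\<^bsub>G Mod K\<^esub> T \<otimes>\<^bsub>G Mod K\<^esub> S \<in> (\<lambda>x. K #> x) ` ?A"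
    obtain x where x: "x \<in> carrier G" "S = K #> x" using S carrQ by auto
    obtain y where y: "T = K #> y" "y \<in> ?A" using T by (rule imageE)
    have yc: "y \<in> carrier G" using y(2) A_sub by blast
    have "x \<notin> ?A" using S x(2) by blast
    have "K #> (inv x \<otimes> y \<otimes> x) = inv\<^bsub>G Mod K\<^esub> S \<otimes>\<^bsub>G Mod K\<^esub> T \<otimes>\<^bsub>G Mod K\<^esub> S"
      using x y(1) yc by (simp only: \<pi>.hom_mult \<pi>.hom_inv m_closed inv_closed)
    then have "inv x \<otimes> y \<otimes> x \<in> ?A" using STS x yc by (intro mem_A) auto
    then have "y \<in> K"
      unfolding K_def using y(2) maximal_inter_conjugate_in_core[OF fin A _ max x(1) \<open>x \<notin> ?A\<close> y(2)]
        A.m_comm by auto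
    then show "T = \<one>\<^bsub>G Mod K\<^esub>"
      using y(1) coset_join2[OF yc K.subgroup_axioms] by simp
  qed
  have maxQ: "H = (\<lambda>x. K #> x) ` ?A \<or> H = carrier (G Mod K)"
    if H: "subgroup H (G Mod K)" "(\<lambda>x. K #> x) ` ?A \<subseteq> H" for H
  proof -
    let ?H = "{x \<in> carrier G. K #> x \<in> H}"
    have "subgroup ?H G"
    proof (rule subgroupI)
      fix h assume h: "h \<in> ?H"
      then show "inv h \<in> ?H"
        using subgroup.m_inv_closed[OF H(1)] \<pi>.hom_inv[of h] by auto
      fix k assume "k \<in> ?H"
      then show "h \<otimes> k \<in> ?H"
        using h subgroup.m_closed[OF H(1)] \<pi>.hom_mult[of h k] by auto
    qed (use subgroup.one_closed[OF H(1)] \<pi>.hom_one in auto)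
    moreover have "?A \<subseteq> ?H" using A_sub H(2) by auto
    ultimately have "?H = ?A \<or> ?H = carrier G" by (rule max)
    moreover have "H = (\<lambda>x. K #> x) ` ?H"
      using subgroup.subset[OF H(1)] carrQ by auto
    ultimately show ?thesis unfolding carrQ by (elim disjE) (simp_all only: simp_thms)
  qed
  have properQ: "(\<lambda>x. K #> x) ` ?A \<noteq> carrier (G Mod K)"
  proof
    assume eq: "(\<lambda>x. K #> x) ` ?A = carrier (G Mod K)"
    have "x \<in> ?A" if x: "x \<in> carrier G" for x
      using mem_A[OF x] \<pi>.hom_closed[OF x] unfolding eq .
    then show False using proper A_sub by blast
  qed
  have finQ: "finite (carrier (G Mod K))" using fin carrQ by simp
  obtain p k where pk: "Factorial_Ring.prime p" "k > 0"
      "order (G Mod K) = p ^ k * card ((\<lambda>x. K #> x) ` ?A)"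
    using Q.index_of_maximal_malnormal_cyclic[OF finQ \<pi>.hom_closed[OF a], unfolded gen, OF mal maxQ properQ] .
  have "subgroup K (G\<lparr>carrier := ?A\<rparr>)"
    using K_A by (intro subgroup_incl K.subgroup_axioms A)
  then have "card (rcosets\<^bsub>G\<lparr>carrier := ?A\<rparr>\<^esub> K) * card K = card ?A"
    using A.lagrange by (simp add: order_def)
  moreover have "rcosets\<^bsub>G\<lparr>carrier := ?A\<rparr>\<^esub> K = (\<lambda>x. K #> x) ` ?A"
    by (auto simp: RCOSETS_def r_coset_def)
  moreover have "order (G Mod K) * card K = order G"
    using lagrange[OF K.subgroup_axioms] by (simp add: order_def FactGroup_def)
  ultimately have "order G = p ^ k * card ?A" using pk(3) by (simp add: mult.assoc)
  then show thesis using that pk(1,2) by blast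
qed

end

section \<open>Primitive actions on vertices\<close>

text \<open>The \<open>H\<close>-orbit of the base vertex is a block. If it is a single vertex,
  \<open>H\<close> is the stabiliser; if it is the whole vertex set, \<open>H\<close> is the whole
  group.\<close>

lemma (in orientably_regular_map) primitive_imp_maximal:
  assumes "primitive_action G (map_vertices G r) (vertex_action G r)"
    and H: "subgroup H G" "generate G {r} \<subseteq> H"
  shows "H = generate G {r} \<or> H = carrier G"
proof -
  interpret primitive_action G "map_vertices G r" "vertex_action G r" by fact
  let ?A = "generate G {r}" and ?B = "(\<lambda>h. h <# generate G {r}) ` H"
  note H_carrier = subgroup.mem_carrier[OF H(1)]
  have vertex: "g <# ?A \<in> map_vertices G r" if "g \<in> carrier G" for g
    using that by (auto simp: map_vertices_def LCOSETS_def)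
  have act: "vertex_action G r g (h <# ?A) = (g \<otimes> h) <# ?A" if "g \<in> carrier G" "h \<in> carrier G" for g h
    using that vertex subset_r by (simp add: vertex_action_def lcos_m_assoc)
  \<comment> \<open>\<open>H\<close> contains \<open>?A\<close>, hence is a union of left cosets of
    \<open>?A\<close>, so every representative of a vertex in \<open>?B\<close> lies in
    \<open>H\<close>.\<close>
  have mem_H: "g \<in> H" if g: "g \<in> carrier G" "g <# ?A \<in> ?B" for g
  proof -
    obtain h where h: "g <# ?A = h <# ?A" "h \<in> H" using g(2) by (rule imageE)
    have "g \<in> h <# ?A" using lcos_self[OF g(1) subgroup_r] h(1) by simp
    then show ?thesis using h(2) H subgroup.m_closed[OF H(1)] by (auto simp: l_coset_def)
  qed
  have img: "vertex_action G r g ` ?B = (\<lambda>h. (g \<otimes> h) <# ?A) ` H" if "g \<in> carrier G" for g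
    using act[OF that] H_carrier by (auto simp: image_image)
  \<comment> \<open>If \<open>g\<close> sends the vertex of some \<open>h\<close> in
    \<open>H\<close> into \<open>?B\<close>, then \<open>g \<otimes> h\<close> and therefore
    \<open>g\<close> lie in \<open>H\<close>, and elements of \<open>H\<close> preserve
    \<open>?B\<close>.\<close>
  have "vertex_action G r g ` ?B = ?B" if g: "g \<in> carrier G" and meet: "vertex_action G r g ` ?B \<inter> ?B \<noteq> {}" for g
  proof -
    from meet obtain h where h: "h \<in> H" "(g \<otimes> h) <# ?A \<in> ?B" unfolding img[OF g] by blast
    then have "g \<otimes> h \<in> H" using g H_carrier by (intro mem_H) auto
    then have "g \<otimes> h \<otimes> inv h \<in> H" using h(1) H(1) by (simp add: subgroup.m_closed subgroup.m_inv_closed)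
    then have gH: "g \<in> H" using g h(1) H_carrier by (simp add: m_assoc)
    have "h <# ?A \<in> (\<lambda>h. (g \<otimes> h) <# ?A) ` H" if "h \<in> H" for h
    proof
      show "h <# ?A = (g \<otimes> (inv g \<otimes> h)) <# ?A" using g that H_carrier by (simp add: inv_mult_cancel)
      show "inv g \<otimes> h \<in> H" using gH that H(1) by (simp add: subgroup.m_closed subgroup.m_inv_closed)
    qed
    moreover have "(\<lambda>h. (g \<otimes> h) <# ?A) ` H \<subseteq> ?B" using gH subgroup.m_closed[OF H(1)] by blast
    ultimately show ?thesis unfolding img[OF g] by blast
  qed
  then have "action_block G (map_vertices G r) (vertex_action G r) ?B"
    unfolding action_block_def using vertex H_carrier subgroup.one_closed[OF H(1)] by blast
  then have "(\<exists>C. ?B = {C}) \<or> ?B = map_vertices G r" by (rule trivial_blocks)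
  then consider C where "?B = {C}" | "?B = map_vertices G r" by (elim disjE exE)
  then show ?thesis
  proof cases
    case 1
    have "h \<in> ?A" if h: "h \<in> H" for h
    proof -
      have "h <# ?A \<in> ?B" "\<one> <# ?A \<in> ?B"
        using h subgroup.one_closed[OF H(1)] by (auto intro: imageI)
      then have "h <# ?A = \<one> <# ?A" unfolding 1 by simp
      then show ?thesis using lcos_self[OF H_carrier[OF h] subgroup_r] lcos_mult_one[OF subset_r] by simp
    qed
    then show ?thesis using H(2) by blast
  next
    case 2
    have "g \<in> H" if "g \<in> carrier G" for g
      using mem_H[OF that] vertex[OF that] unfolding 2 .
    then show ?thesis using subgroup.subset[OF H(1)] by blast
  qed
qed

theorem theorem6p1:
  fixes G :: "('a, 'b) monoid_scheme" (structure) and r l :: 'a and \<pi> :: "nat set"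
  assumes "orientably_regular_map G r l"
    and "\<pi> = {p. Factorial_Ring.prime p \<and> p dvd card (map_vertices G r)}"
    and "primitive_action G (map_vertices G r) (vertex_action G r)"
  shows "\<exists>p. \<pi> = {p}"
proof -
  interpret orientably_regular_map G r l by fact
  interpret primitive_action G "map_vertices G r" "vertex_action G r" by fact
  have card: "card (map_vertices G r) * card (generate G {r}) = order G"
    unfolding map_vertices_def by (rule l_lagrange[OF finite_carrier subgroup_r])
  have pos: "card (generate G {r}) > 0"
    using finite_subset[OF subset_r finite_carrier] base_vertex generate.one[of G "{r}"]
    by (auto simp: card_gt_0_iff)
  have "generate G {r} \<noteq> carrier G"
  proof
    assume "generate G {r} = carrier G"
    then have "card (map_vertices G r) = 1" using card pos by (simp add: order_def)
    then show False using not_singleton by (metis card_1_singletonE singletonD)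
  qed
  then obtain p k where pk: "Factorial_Ring.prime p" "k > 0" "order G = p ^ k * card (generate G {r})"
    using index_of_maximal_cyclic[OF finite_carrier r_closed] primitive_imp_maximal[OF assms(3)]
    by metis
  then have "card (map_vertices G r) = p ^ k" using card pos by simp
  \<comment> \<open>Here \<open>k > 0\<close> ensures that \<open>p\<close> itself belongs to
    \<open>\<pi>\<close>.\<close>
  then have "\<pi> = {p}"
    using assms(2) pk(1,2) by (auto dest: prime_dvd_power primes_dvd_imp_eq)
  then show ?thesis by blast
qed

end
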